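(* Let $\rho \in [0,1]$ be a fixed real constant. For each integer $M \ge 1$ let $\Sigma_e^{(M)} \in \mathbb{R}^{M\times M}$ be the matrix with entries $\rho^{|i-j|}$, and let $C_{\Sigma_e}^{(M)}$ be the $M\times M$ circulant matrix with first row $(c_0, \dots, c_{M-1})$ given by $$c_m = \rho^m + \frac{m}{M}\left(\rho^{M-m} - \rho^m\right), \qquad 0 \le m \le M-1.$$ Then $C_{\Sigma_e}^{(M)}$ and $\Sigma_e^{(M)}$ are asymptotically equivalent in the weak norm, i.e. $$\lim_{M\to\infty} \frac{1}{\sqrt{M}} \left\| \Sigma_e^{(M)} - C_{\Sigma_e}^{(M)} \right\|_F = 0.$$
   Context: A matrix $C$ is circulant with first row $(c_0, c_1, \dots, c_{M-1})$ if $C_{ij} = c_{(j-i) \bmod M}$. The Frobenius (weak) norm of a real matrix $A$ is $\|A\|_F = \sqrt{\operatorname{trace}(A^{\mathsf{T}}A)}$. Two families of $M \times M$ matrices $A$, $B$ are asymptotically equivalent in the weak norm if $\lim_{M\to\infty} M^{-1/2}\|A-B\|_F = 0$. The convention $0^0=1$ is used. *)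

theory Defs
  imports Complex_Main "Jordan_Normal_Form.Matrix"
begin

definition mat_trace :: "'a::comm_monoid_add mat \<Rightarrow> 'a" where
  "mat_trace A = (\<Sum>i<dim_row A. A $$ (i, i))"

definition frobenius_norm :: "real mat \<Rightarrow> real" where
  "frobenius_norm A = sqrt (mat_trace (transpose_mat A * A))"

text \<open>The index \<open>j - i\<close> is reduced modulo \<open>M\<close> in the integers, since subtraction of
  natural numbers truncates.\<close>

definition circulant_mat :: "nat \<Rightarrow> (nat \<Rightarrow> 'a) \<Rightarrow> 'a mat" where
  "circulant_mat M c = mat M M (\<lambda>(i, j). c (nat ((int j - int i) mod int M)))"

definition weakly_asymp_equiv :: "(nat \<Rightarrow> real mat) \<Rightarrow> (nat \<Rightarrow> real mat) \<Rightarrow> bool" where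
  "weakly_asymp_equiv A B \<longleftrightarrow>
     (\<forall>M\<ge>1. A M \<in> carrier_mat M M \<and> B M \<in> carrier_mat M M) \<and>
     (\<lambda>M. 1 / sqrt (real M) * frobenius_norm (A M - B M)) \<longlonglongrightarrow> 0"

text \<open>Natural-number powers satisfy \<open>0 ^ 0 = 1\<close>, so the case \<open>\<rho> = 0\<close> needs no separate clause.\<close>

definition Sigma_e :: "real \<Rightarrow> nat \<Rightarrow> real mat" where
  "Sigma_e \<rho> M = mat M M (\<lambda>(i, j). \<rho> ^ nat \<bar>int i - int j\<bar>)"

text \<open>Only the values for \<open>m < M\<close> are used, so \<open>M - m\<close> never truncates.\<close>

definition c_Sigma_e :: "real \<Rightarrow> nat \<Rightarrow> nat \<Rightarrow> real" where
  "c_Sigma_e \<rho> M m = \<rho> ^ m + real m / real M * (\<rho> ^ (M - m) - \<rho> ^ m)"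

definition C_Sigma_e :: "real \<Rightarrow> nat \<Rightarrow> real mat" where
  "C_Sigma_e \<rho> M = circulant_mat M (c_Sigma_e \<rho> M)"

end

theory Submission
  imports Defs
begin

text \<open>
  With \<open>d = \<bar>i - j\<bar>\<close>, both the upper and the lower triangle of the circulant matrix reproduce
  \<open>\<rho> ^ d\<close> up to the error \<open>d / M * (\<rho> ^ d - \<rho> ^ (M - d))\<close>, because \<open>c\<close> satisfies
  \<open>c (M - d) = c d\<close> for \<open>0 < d < M\<close>. For \<open>\<rho> = 1\<close> the error vanishes identically. For \<open>\<rho> < 1\<close> the squared
  Frobenius norm of the error stays bounded in \<open>M\<close>, so dividing the norm by \<open>sqrt M\<close> sends it
  to zero.

  Boundedness has two sources. Near the diagonal, the weight \<open>d / M\<close> compensates for the \<open>M\<close>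
  rows: each row contributes at most \<open>1 / M\<close> times two copies of the convergent series
  \<open>\<Sum>n. n * \<rho> ^ n\<close>. In the two corners, where \<open>M - d\<close> is small, the term \<open>\<rho> ^ (M - d)\<close> splits
  as a product \<open>\<rho> ^ (M - j) * \<rho> ^ i\<close> (or its mirror image), which decays in both indices, so
  the whole double sum is at most twice the square of a geometric series. A bound uniform over the rows would
  not suffice there: for \<open>0 < \<rho> < 1\<close> the contribution of the first row does not tend to zero.
\<close>

section \<open>The Frobenius norm as a sum over entries\<close>

lemma frobenius_norm_eq_sum:
  assumes "A \<in> carrier_mat m n"
  shows "frobenius_norm A = sqrt (\<Sum>j<n. \<Sum>i<m. (A $$ (i, j))\<^sup>2)"
  using assms
  by (auto simp: frobenius_norm_def mat_trace_def scalar_prod_def power2_eq_square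
      lessThan_atLeast0 intro!: sum.cong)

lemma frobenius_norm_minus_commute:
  assumes "A \<in> carrier_mat m n" "B \<in> carrier_mat m n"
  shows "frobenius_norm (A - B) = frobenius_norm (B - A)"
proof -
  have "A - B \<in> carrier_mat m n" "B - A \<in> carrier_mat m n"
    using assms by auto
  thus ?thesis
    using assms by (simp add: frobenius_norm_eq_sum power2_commute)
qed

section \<open>The entries of the error\<close>

lemma c_Sigma_e_reflect:
  assumes "0 < d" "d < M"
  shows "c_Sigma_e \<rho> M (M - d) = c_Sigma_e \<rho> M d"
  using assms by (simp add: c_Sigma_e_def of_nat_diff field_simps)

lemma C_Sigma_e_entry:
  assumes "i < M" "j < M"
  shows "C_Sigma_e \<rho> M $$ (i, j) = c_Sigma_e \<rho> M (nat \<bar>int i - int j\<bar>)"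
proof (cases "i \<le> j")
  case True
  hence "(int j - int i) mod int M = int j - int i"
    using assms by (intro mod_pos_pos_trivial) auto
  thus ?thesis
    using True assms by (simp add: C_Sigma_e_def circulant_mat_def)
next
  case False
  have "(int j - int i) mod int M = (int j - int i + int M) mod int M"
    by simp
  also have "\<dots> = int j - int i + int M"
    using False assms by (intro mod_pos_pos_trivial) auto
  finally have "nat ((int j - int i) mod int M) = M - (i - j)"
    using False assms by linarith
  moreover have "nat \<bar>int i - int j\<bar> = i - j"
    using False by linarith
  ultimately show ?thesis
    using c_Sigma_e_reflect[of "i - j" M \<rho>] False assms
    by (simp add: C_Sigma_e_def circulant_mat_def del: diff_diff_right)
qed

lemma error_entry:
  assumes "i < M" "j < M"
  defines "d \<equiv> nat \<bar>int i - int j\<bar>"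
  shows "(Sigma_e \<rho> M - C_Sigma_e \<rho> M) $$ (i, j) = real d / real M * (\<rho> ^ d - \<rho> ^ (M - d))"
proof -
  have "C_Sigma_e \<rho> M \<in> carrier_mat M M"
    by (simp add: C_Sigma_e_def circulant_mat_def)
  hence "(Sigma_e \<rho> M - C_Sigma_e \<rho> M) $$ (i, j) = \<rho> ^ d - c_Sigma_e \<rho> M d"
    using assms(1,2) by (simp add: C_Sigma_e_entry) (simp add: Sigma_e_def d_def)
  thus ?thesis
    by (simp add: c_Sigma_e_def algebra_simps)
qed

text \<open>
  The first summand carries the error near the diagonal, the other two the corners: the exponent
  \<open>M - \<bar>i - j\<bar>\<close> equals \<open>(M - j) + i\<close> above the diagonal and \<open>(M - i) + j\<close> below it.
  The decay in \<open>i\<close> and \<open>j\<close> separately is what makes the corner terms summable over both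
  indices.
\<close>

lemma error_entry_square_le:
  assumes "0 \<le> \<rho>" "\<rho> \<le> 1" "i < M" "j < M"
  defines "d \<equiv> nat \<bar>int i - int j\<bar>"
  shows "((Sigma_e \<rho> M - C_Sigma_e \<rho> M) $$ (i, j))\<^sup>2
    \<le> real d * \<rho> ^ d / real M + (\<rho> ^ (M - j) * \<rho> ^ i + \<rho> ^ (M - i) * \<rho> ^ j)"
proof -
  define a b w where "a = \<rho> ^ d" and "b = \<rho> ^ (M - d)" and "w = real d / real M"
  have a: "0 \<le> a" "a \<le> 1" and b: "0 \<le> b" "b \<le> 1"
    using assms(1,2) by (auto simp: a_def b_def power_le_one)
  have w: "0 \<le> w" "w \<le> 1"
    using assms(3,4) by (auto simp: w_def d_def divide_simps)
  have "(w * (a - b))\<^sup>2 = w\<^sup>2 * (a - b)\<^sup>2"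
    by (simp add: power_mult_distrib)
  also have "\<dots> \<le> w * (a + b)"
  proof (rule mult_mono)
    show "w\<^sup>2 \<le> w"
      using w by (simp add: power2_eq_square mult_left_le)
    have "a\<^sup>2 \<le> a" "b\<^sup>2 \<le> b" "0 \<le> a * b"
      using a b by (auto simp: power2_eq_square mult_left_le)
    thus "(a - b)\<^sup>2 \<le> a + b"
      by (simp add: power2_diff)
  qed (use w in auto)
  also have "\<dots> \<le> w * a + b"
    using mult_left_le_one_le[OF b(1) w] by (simp add: distrib_left)
  also have "b \<le> \<rho> ^ (M - j) * \<rho> ^ i + \<rho> ^ (M - i) * \<rho> ^ j"
  proof (cases "i \<le> j")
    case True
    hence "M - d = (M - j) + i"
      using assms(3,4) unfolding d_def by linarith
    thus ?thesis
      using assms(1) by (simp add: b_def power_add)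
  next
    case False
    hence "M - d = (M - i) + j"
      using assms(3,4) unfolding d_def by linarith
    thus ?thesis
      using assms(1) by (simp add: b_def power_add)
  qed
  finally show ?thesis
    using error_entry[OF assms(3,4), of \<rho>]
    by (simp add: a_def b_def w_def flip: d_def)
qed

section \<open>Bounding the double sum\<close>

lemma sum_inj_le_suminf:
  fixes g :: "nat \<Rightarrow> real"
  assumes "summable g" "\<And>n. 0 \<le> g n" "finite A" "inj_on h A"
  shows "(\<Sum>x\<in>A. g (h x)) \<le> suminf g"
proof -
  have "(\<Sum>x\<in>A. g (h x)) = sum g (h ` A)"
    using assms(4) by (simp add: sum.reindex)
  also have "\<dots> \<le> suminf g"
    using assms by (intro sum_le_suminf) auto
  finally show ?thesis .
qed

text \<open>Along a row, each distance from the diagonal occurs at most twice, once on either side.\<close>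

lemma sum_abs_diff_le_suminf:
  fixes g :: "nat \<Rightarrow> real"
  assumes "summable g" "\<And>n. 0 \<le> g n"
  shows "(\<Sum>i<M. g (nat \<bar>int i - int j\<bar>)) \<le> 2 * suminf g"
proof -
  have "(\<Sum>i<M. g (nat \<bar>int i - int j\<bar>))
      = (\<Sum>i\<in>{..<M} \<inter> {..j}. g (nat \<bar>int i - int j\<bar>))
        + (\<Sum>i\<in>{..<M} - {..j}. g (nat \<bar>int i - int j\<bar>))"
    by (rule sum.Int_Diff) simp
  also have "\<dots> \<le> suminf g + suminf g"
    by (intro add_mono sum_inj_le_suminf assms) (auto simp: inj_on_def)
  finally show ?thesis by simp
qed

lemma sum_error_square_le:
  assumes "0 \<le> \<rho>" "\<rho> < 1"
  shows "(\<Sum>j<M. \<Sum>i<M. ((Sigma_e \<rho> M - C_Sigma_e \<rho> M) $$ (i, j))\<^sup>2)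
    \<le> 2 * (\<Sum>n. real n * \<rho> ^ n) + 2 * (\<Sum>n. \<rho> ^ n)\<^sup>2"
proof -
  define T S where "T = (\<Sum>n. real n * \<rho> ^ n)" and "S = (\<Sum>n. \<rho> ^ n)"
  have sumT: "summable (\<lambda>n. real n * \<rho> ^ n)"
  proof (rule summable_comparison_test')
    show "summable (\<lambda>n. real (Suc n) * \<rho> ^ n)"
      using geometric_deriv_sums[of \<rho>] assms by (auto dest: sums_summable)
    show "norm (real n * \<rho> ^ n) \<le> real (Suc n) * \<rho> ^ n" for n
      using assms(1) by (simp add: mult_right_mono)
  qed
  have sumS: "summable (\<lambda>n. \<rho> ^ n)"
    using assms by (simp add: summable_geometric)
  have T0: "0 \<le> T"
    unfolding T_def using assms sumT by (intro suminf_nonneg) auto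
  have "(\<Sum>j<M. \<Sum>i<M. ((Sigma_e \<rho> M - C_Sigma_e \<rho> M) $$ (i, j))\<^sup>2)
    \<le> (\<Sum>j<M. \<Sum>i<M. real (nat \<bar>int i - int j\<bar>) * \<rho> ^ nat \<bar>int i - int j\<bar> / real M
        + (\<rho> ^ (M - j) * \<rho> ^ i + \<rho> ^ (M - i) * \<rho> ^ j))"
    using assms by (intro sum_mono error_entry_square_le) auto
  also have "\<dots> = (\<Sum>j<M. (\<Sum>i<M. real (nat \<bar>int i - int j\<bar>) * \<rho> ^ nat \<bar>int i - int j\<bar>) / real M)
      + 2 * ((\<Sum>j<M. \<rho> ^ (M - j)) * (\<Sum>i<M. \<rho> ^ i))"
    by (simp add: sum.distrib sum_divide_distrib sum_product
        sum.swap[of "\<lambda>j i. \<rho> ^ (M - i) * \<rho> ^ j"])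
  also have "\<dots> \<le> (\<Sum>j<M. 2 * T / real M) + 2 * (S * S)"
  proof (intro add_mono sum_mono divide_right_mono mult_left_mono mult_mono)
    show "(\<Sum>i<M. real (nat \<bar>int i - int j\<bar>) * \<rho> ^ nat \<bar>int i - int j\<bar>) \<le> 2 * T" for j
      unfolding T_def using sumT assms(1) by (intro sum_abs_diff_le_suminf) auto
    show "(\<Sum>j<M. \<rho> ^ (M - j)) \<le> S"
      unfolding S_def using sumS assms(1) by (intro sum_inj_le_suminf) (auto simp: inj_on_def)
    show "(\<Sum>i<M. \<rho> ^ i) \<le> S"
      unfolding S_def using sumS assms(1) by (intro sum_le_suminf) auto
    show "0 \<le> S"
      unfolding S_def using sumS assms(1) by (intro suminf_nonneg) auto
  qed (use assms(1) in \<open>auto intro: sum_nonneg\<close>)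
  also have "\<dots> \<le> 2 * T + 2 * S\<^sup>2"
    using T0 by (cases "M = 0") (auto simp: power2_eq_square)
  finally show ?thesis
    by (simp add: T_def S_def)
qed

lemma frobenius_error_bounded:
  assumes "0 \<le> \<rho>" "\<rho> \<le> 1"
  obtains K where "\<And>M. frobenius_norm (Sigma_e \<rho> M - C_Sigma_e \<rho> M) \<le> K"
proof -
  have norm_eq: "frobenius_norm (Sigma_e \<rho> M - C_Sigma_e \<rho> M)
      = sqrt (\<Sum>j<M. \<Sum>i<M. ((Sigma_e \<rho> M - C_Sigma_e \<rho> M) $$ (i, j))\<^sup>2)" for M
    by (rule frobenius_norm_eq_sum) (simp add: C_Sigma_e_def circulant_mat_def minus_carrier_mat)
  show thesis
  proof (cases "\<rho> = 1")
    case True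
    hence "frobenius_norm (Sigma_e \<rho> M - C_Sigma_e \<rho> M) \<le> 0" for M
      unfolding norm_eq by (simp add: error_entry)
    thus thesis by (rule that)
  next
    case False
    hence "\<rho> < 1" using assms(2) by simp
    from sum_error_square_le[OF assms(1) this] show thesis
      by (intro that[of "sqrt (2 * (\<Sum>n. real n * \<rho> ^ n) + 2 * (\<Sum>n. \<rho> ^ n)\<^sup>2)"])
        (simp add: norm_eq)
  qed
qed

theorem mainTheorem4:
  fixes \<rho> :: real
  assumes "0 \<le> \<rho>" and "\<rho> \<le> 1"
  shows "weakly_asymp_equiv (C_Sigma_e \<rho>) (Sigma_e \<rho>) \<and>
    (\<lambda>M. 1 / sqrt (real M) * frobenius_norm (Sigma_e \<rho> M - C_Sigma_e \<rho> M)) \<longlonglongrightarrow> 0"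
proof -
  have carrier: "C_Sigma_e \<rho> M \<in> carrier_mat M M" "Sigma_e \<rho> M \<in> carrier_mat M M" for M
    by (auto simp: C_Sigma_e_def circulant_mat_def Sigma_e_def)
  obtain K where K: "\<And>M. frobenius_norm (Sigma_e \<rho> M - C_Sigma_e \<rho> M) \<le> K"
    using frobenius_error_bounded[OF assms] by blast
  have nonneg: "0 \<le> frobenius_norm (Sigma_e \<rho> M - C_Sigma_e \<rho> M)" for M
    by (subst frobenius_norm_eq_sum[where m = M and n = M])
      (use carrier in \<open>auto intro!: sum_nonneg minus_carrier_mat\<close>)
  have "(\<lambda>M. 1 / sqrt (real M)) \<longlonglongrightarrow> 0"
    by (intro tendsto_divide_0[OF tendsto_const] filterlim_at_top_imp_at_infinity
        filterlim_compose[OF sqrt_at_top filterlim_real_sequentially])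
  hence "(\<lambda>M. 1 / sqrt (real M) * K) \<longlonglongrightarrow> 0"
    by (rule tendsto_mult_left_zero)
  hence limit: "(\<lambda>M. 1 / sqrt (real M) * frobenius_norm (Sigma_e \<rho> M - C_Sigma_e \<rho> M)) \<longlonglongrightarrow> 0"
    by (rule tendsto_sandwich[OF _ _ tendsto_const, rotated 2])
      (auto intro!: always_eventually divide_right_mono simp: K nonneg)
  thus ?thesis
    using carrier frobenius_norm_minus_commute[OF carrier]
    by (simp add: weakly_asymp_equiv_def)
qed

end
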